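(* Let $H$ be a real Hilbert space with $\dim H\geq 3$, let $k\geq 3$ be an integer and let $F\subset[0,1]$. The following conditions are equivalent: (1) there exist non-empty, convex and closed subsets $A_1,A_2,\dots,A_k\subset H$ such that $$F=\{\alpha\in[0,1]:P_{A_k}^\alpha P_{A_{k-1}}^\alpha\cdots P_{A_1}^\alpha\text{ has a fixed point}\};$$ (2) $0\in F$ and $F$ is an $F_\sigma$ subset of $[0,1]$.
   Context: For a non-empty, convex, closed subset $A$ of a real Hilbert space $H$, $P_A:H\to A$ denotes the metric (nearest-point) projection onto $A$. For $\alpha\in[0,1]$, the $\alpha$-relaxed projection onto $A$ is the map $P_A^\alpha:H\to H$, $P_A^\alpha(x)=\alpha P_A(x)+(1-\alpha)x$. Compositions are written as products, e.g. $P_{A_2}^\alpha P_{A_1}^\alpha=P_{A_2}^\alpha\circ P_{A_1}^\alpha$. *)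

theory Defs
  imports "HOL-Analysis.Analysis"
begin

text \<open>Metric (nearest-point) projection onto a set A of a real Hilbert space.
  For non-empty closed convex A the nearest point exists and is unique.\<close>
definition metric_proj :: "'a::{real_inner,complete_space} set \<Rightarrow> 'a \<Rightarrow> 'a" where
  "metric_proj A x = (THE y. y \<in> A \<and> (\<forall>z\<in>A. dist x y \<le> dist x z))"

definition relaxed_proj :: "real \<Rightarrow> 'a::{real_inner,complete_space} set \<Rightarrow> 'a \<Rightarrow> 'a" where
  "relaxed_proj \<alpha> A x = \<alpha> *\<^sub>R metric_proj A x + (1 - \<alpha>) *\<^sub>R x"

primrec relaxed_comp :: "real \<Rightarrow> (nat \<Rightarrow> 'a::{real_inner,complete_space} set) \<Rightarrow> nat \<Rightarrow> 'a \<Rightarrow> 'a" where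
  "relaxed_comp \<alpha> A 0 = id"
| "relaxed_comp \<alpha> A (Suc n) = relaxed_proj \<alpha> (A (Suc n)) \<circ> relaxed_comp \<alpha> A n"

end

theory Submission
  imports Defs
begin

text \<open>
  (1) implies (2): the parameters having a fixed point of norm at most \<open>n\<close> form a set whose closure
  consists of parameters with fixed points, since limits of such parameters yield bounded sequences
  of approximate fixed points, whose asymptotic centres are fixed by nonexpansiveness.

  (2) implies (1): three sets suffice, the others being the whole space. Project orthogonally to the
  plane of \<open>e1\<close> and \<open>e2\<close>, and let \<open>A 1\<close>, \<open>A 2\<close> be the fibres over points \<open>p\<close>, \<open>q\<close> of the plane.
  Relaxed projections onto fibres change only the planar part, so at a fixed point the displacement
  towards \<open>A 3\<close> is planar. If the shadow of \<open>A 3\<close> lies between the open and the closed unit disc,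
  the planar parts form an \<open>\<alpha>\<close>-cycle of \<open>p\<close>, \<open>q\<close> and the closed disc, whose point in the disc is
  \<open>sgn ((1 - \<alpha>) p + q)\<close>, an injective curve in the unit circle. Hence a fixed point exists iff
  that point lies in the shadow of \<open>A 3\<close>. A third dimension allows \<open>A 3\<close> to be an epigraph whose
  shadow meets this curve exactly in the parameters from a prescribed \<open>F\<^sub>\<sigma>\<close> set.
\<close>

section \<open>Minimisers of uniformly convex functions\<close>

lemma parallelogram_midpoint:
  fixes x y z :: "'a::real_inner"
  shows "(norm (z - midpoint x y))\<^sup>2
      = ((norm (z - x))\<^sup>2 + (norm (z - y))\<^sup>2) / 2 - (norm (x - y))\<^sup>2 / 4"
  unfolding power2_norm_eq_inner midpoint_def
  by (simp add: algebra_simps inner_commute) (simp add: field_simps)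

text \<open>The hypothesis \<open>mid\<close> is uniform convexity of \<open>f\<close> squared with
  the Hilbert modulus: it makes minimising sequences Cauchy. Applied to \<open>dist x\<close> it
  gives nearest points, applied to an asymptotic radius it gives asymptotic centres.\<close>

lemma uniformly_convex_minimiser:
  fixes f :: "'a::{real_inner,complete_space} \<Rightarrow> real"
  assumes C: "C \<noteq> {}" "convex C" "closed C"
    and cont: "continuous_on C f"
    and nn: "\<And>x. f x \<ge> 0"
    and mid: "\<And>x y. (f (midpoint x y))\<^sup>2 \<le> ((f x)\<^sup>2 + (f y)\<^sup>2) / 2 - (norm (x - y))\<^sup>2 / 4"
  obtains c where "c \<in> C" "\<And>y. y \<in> C \<Longrightarrow> f c \<le> f y" "\<And>y. y \<in> C \<Longrightarrow> f y \<le> f c \<Longrightarrow> y = c"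
proof -
  define g where "g x = (f x)\<^sup>2" for x
  define m where "m = Inf (g ` C)"
  have bdd: "bdd_below (g ` C)"
    by (rule bdd_belowI[of _ 0]) (auto simp: g_def)
  have m_le: "m \<le> g x" if "x \<in> C" for x
    unfolding m_def using bdd that by (intro cInf_lower) auto
  have midC: "midpoint x y \<in> C" if "x \<in> C" "y \<in> C" for x y
    using C(2) that by (metis convex_contains_segment midpoint_in_closed_segment subsetD)
  \<comment> \<open>The midpoint lies in \<open>C\<close>, so its value is at least
    \<open>m\<close>; hence almost minimal points are close together. This yields both the Cauchy
    property and uniqueness.\<close>
  have gap: "(norm (x - y))\<^sup>2 \<le> 2 * (g x - m) + 2 * (g y - m)" if "x \<in> C" "y \<in> C" for x y
  proof -
    have "m \<le> (g x + g y) / 2 - (norm (x - y))\<^sup>2 / 4"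
      using m_le[OF midC[OF that]] mid[of x y] by (simp add: g_def)
    then show ?thesis by argo
  qed
  have "\<exists>x\<in>C. g x < m + inverse (real (Suc n))" for n
  proof -
    have "Inf (g ` C) < m + inverse (real (Suc n))"
      unfolding m_def by (simp add: add_pos_pos)
    then show ?thesis
      using cInf_lessD[of "g ` C"] C(1) by blast
  qed
  then obtain X where X: "\<And>n. X n \<in> C" "\<And>n. g (X n) < m + inverse (real (Suc n))"
    by metis
  have "Cauchy X"
  proof (rule metric_CauchyI)
    fix e :: real assume e: "e > 0"
    obtain N where N: "inverse (real (Suc N)) < e\<^sup>2 / 4"
      using reals_Archimedean[of "e\<^sup>2 / 4"] e by auto
    have small: "g (X n) - m < e\<^sup>2 / 4" if "n \<ge> N" for n
    proof -
      have "inverse (real (Suc n)) \<le> inverse (real (Suc N))"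
        using that by (intro le_imp_inverse_le) auto
      then show ?thesis using X(2)[of n] N by linarith
    qed
    show "\<exists>N. \<forall>i\<ge>N. \<forall>j\<ge>N. dist (X i) (X j) < e"
    proof (intro exI allI impI)
      fix i j assume "i \<ge> N" "j \<ge> N"
      then have "(norm (X i - X j))\<^sup>2 < e\<^sup>2"
        using gap[OF X(1) X(1), of i j] small[OF \<open>i \<ge> N\<close>] small[OF \<open>j \<ge> N\<close>] by argo
      then show "dist (X i) (X j) < e"
        using e by (simp add: dist_norm power2_less_imp_less)
    qed
  qed
  then obtain c where c: "X \<longlonglongrightarrow> c"
    using Cauchy_convergent_iff convergent_def by blast
  have cC: "c \<in> C"
    using C(3) X(1) c closed_sequentially by blast
  have "(\<lambda>n. f (X n)) \<longlonglongrightarrow> f c"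
    using cont c cC X(1) by (metis (mono_tags, lifting) continuous_on_sequentially o_def tendsto_cong eventually_sequentiallyI)
  then have "(\<lambda>n. g (X n)) \<longlonglongrightarrow> g c"
    unfolding g_def by (intro tendsto_intros)
  moreover have "(\<lambda>n. m + inverse (real (Suc n))) \<longlonglongrightarrow> m + 0"
    by (intro tendsto_intros LIMSEQ_inverse_real_of_nat)
  ultimately have "g c \<le> m"
    using LIMSEQ_le[of "\<lambda>n. g (X n)" "g c" _ "m + 0"] less_imp_le[OF X(2)] by simp
  show ?thesis
  proof
    show "c \<in> C" by (rule cC)
    show "f c \<le> f y" if "y \<in> C" for y
    proof -
      have "(f c)\<^sup>2 \<le> (f y)\<^sup>2" using m_le[OF that] \<open>g c \<le> m\<close> unfolding g_def by linarith
      then show ?thesis using nn power2_le_imp_le by blast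
    qed
    show "y = c" if "y \<in> C" "f y \<le> f c" for y
    proof -
      have "g y \<le> m" using that(2) nn[of y] \<open>g c \<le> m\<close> unfolding g_def
        by (meson order_trans power_mono)
      then have "(norm (y - c))\<^sup>2 \<le> 0"
        using gap[OF that(1) cC] \<open>g c \<le> m\<close> by argo
      then show ?thesis by simp
    qed
  qed
qed

section \<open>Metric projections\<close>

lemma metric_proj_ex1:
  fixes A :: "'a::{real_inner,complete_space} set"
  assumes "A \<noteq> {}" "convex A" "closed A"
  shows "\<exists>!y. y \<in> A \<and> (\<forall>z\<in>A. dist x y \<le> dist x z)"
proof -
  obtain c where "c \<in> A" "\<And>y. y \<in> A \<Longrightarrow> dist x c \<le> dist x y"
    "\<And>y. y \<in> A \<Longrightarrow> dist x y \<le> dist x c \<Longrightarrow> y = c"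
  proof (rule uniformly_convex_minimiser[OF assms, of "dist x"])
    show "continuous_on A (dist x)" by (intro continuous_intros)
    show "(dist x (midpoint y z))\<^sup>2 \<le> ((dist x y)\<^sup>2 + (dist x z)\<^sup>2) / 2 - (norm (y - z))\<^sup>2 / 4" for y z
      by (simp add: dist_norm parallelogram_midpoint)
  qed auto
  then show ?thesis by (intro ex1I[of _ c]) blast+
qed

lemma
  fixes A :: "'a::{real_inner,complete_space} set"
  assumes "A \<noteq> {}" "convex A" "closed A"
  shows metric_proj_in: "metric_proj A x \<in> A"
    and metric_proj_le: "z \<in> A \<Longrightarrow> dist x (metric_proj A x) \<le> dist x z"
  using theI'[OF metric_proj_ex1[OF assms, of x]] unfolding metric_proj_def by blast+

text \<open>If the angle at the projection were acute, a short move from it towards \<open>y\<close>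
  would stay in \<open>A\<close> and come closer to \<open>x\<close>.\<close>

lemma metric_proj_variational:
  fixes A :: "'a::{real_inner,complete_space} set"
  assumes "A \<noteq> {}" "convex A" "closed A" "y \<in> A"
  shows "(x - metric_proj A x) \<bullet> (y - metric_proj A x) \<le> 0"
proof (rule ccontr)
  define w where "w = metric_proj A x"
  assume "\<not> (x - metric_proj A x) \<bullet> (y - metric_proj A x) \<le> 0"
  then have pos: "(x - w) \<bullet> (y - w) > 0" by (simp add: w_def)
  obtain u where u: "0 < u" "u \<le> 1" "norm ((w + u *\<^sub>R (y - w)) - x) < norm (w - x)"
  proof -
    let ?i = "(x - w) \<bullet> (y - w)" and ?n = "(norm (y - w))\<^sup>2"
    \<comment> \<open>Small enough for the linear gain \<open>2 * u * ?i\<close> to beat the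
      quadratic loss \<open>u * u * ?n\<close>; the \<open>+ 1\<close> keeps the denominator
      positive.\<close>
    define u where "u = min 1 (?i / (?n + 1))"
    have u: "0 < u" "u \<le> 1" using pos by (auto simp: u_def add_nonneg_pos)
    have "u * (?n + 1) \<le> ?i"
    proof -
      have "u \<le> ?i / (?n + 1)" by (simp add: u_def)
      then show ?thesis by (simp add: pos_le_divide_eq add_nonneg_pos)
    qed
    then have "u * ?n < 2 * ?i" using u pos by (simp add: algebra_simps)
    then have "u * (u * ?n) < u * (2 * ?i)" using u by simp
    moreover have "(norm ((w + u *\<^sub>R (y - w)) - x))\<^sup>2 = (norm (w - x))\<^sup>2 - u * (2 * ?i) + u * (u * ?n)"
      unfolding power2_norm_eq_inner by (simp add: algebra_simps inner_commute)
    ultimately have "(norm ((w + u *\<^sub>R (y - w)) - x))\<^sup>2 < (norm (w - x))\<^sup>2" by linarith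
    then show ?thesis using that u power2_less_imp_less norm_ge_zero by blast
  qed
  have "w \<in> A" unfolding w_def by (rule metric_proj_in[OF assms(1-3)])
  then have "(1 - u) *\<^sub>R w + u *\<^sub>R y \<in> A"
    using assms(2,4) u convexD[of A w y "1 - u" u] by simp
  moreover have "(1 - u) *\<^sub>R w + u *\<^sub>R y = w + u *\<^sub>R (y - w)"
    by (simp add: algebra_simps)
  ultimately have "dist x w \<le> dist x (w + u *\<^sub>R (y - w))"
    using metric_proj_le[OF assms(1-3)] by (simp add: w_def)
  then show False using u(3) by (simp add: dist_norm norm_minus_commute)
qed

text \<open>Adding this inequality to the one for the true projection \<open>v\<close> gives a
  nonpositive squared distance between \<open>v\<close> and \<open>w\<close>. Concrete projections
  are computed below by checking a candidate in this way.\<close>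

lemma metric_proj_unique:
  fixes A :: "'a::{real_inner,complete_space} set"
  assumes "convex A" "closed A" "w \<in> A" and var: "\<And>y. y \<in> A \<Longrightarrow> (x - w) \<bullet> (y - w) \<le> 0"
  shows "metric_proj A x = w"
proof -
  define v where "v = metric_proj A x"
  have "A \<noteq> {}" using assms(3) by auto
  then have "v \<in> A" "(x - v) \<bullet> (w - v) \<le> 0"
    unfolding v_def using metric_proj_in metric_proj_variational assms by blast+
  then have "(w - v) \<bullet> (w - v) \<le> 0"
    using var[of v] by (simp add: algebra_simps inner_commute)
  then have "w - v = 0" by (metis inner_ge_zero inner_eq_zero_iff order_antisym)
  then show ?thesis by (simp add: v_def)
qed

lemma metric_proj_UNIV: "metric_proj UNIV x = x"
  by (rule metric_proj_unique) auto

text \<open>The two variational inequalities add up to firm nonexpansiveness, and Cauchy-Schwarz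
  does the rest.\<close>

lemma metric_proj_nonexpansive:
  fixes A :: "'a::{real_inner,complete_space} set"
  assumes A: "A \<noteq> {}" "convex A" "closed A"
  shows "norm (metric_proj A x - metric_proj A y) \<le> norm (x - y)"
proof -
  define v w where "v = metric_proj A x" and "w = metric_proj A y"
  have "(x - v) \<bullet> (w - v) \<le> 0" "(y - w) \<bullet> (v - w) \<le> 0"
    unfolding v_def w_def by (intro metric_proj_variational[OF A] metric_proj_in[OF A])+
  then have "(norm (v - w))\<^sup>2 \<le> (x - y) \<bullet> (v - w)"
    unfolding power2_norm_eq_inner by (simp add: algebra_simps inner_commute)
  also have "\<dots> \<le> norm (x - y) * norm (v - w)" by (rule norm_cauchy_schwarz)
  finally have "norm (v - w) * norm (v - w) \<le> norm (x - y) * norm (v - w)"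
    by (simp add: power2_eq_square)
  then show ?thesis
    unfolding v_def[symmetric] w_def[symmetric]
    by (metis mult_right_le_imp_le norm_ge_zero order_le_less)
qed

section \<open>Relaxed projections and their compositions: dependence on the point and on the
  parameter\<close>

lemma relaxed_proj_nonexpansive:
  fixes A :: "'a::{real_inner,complete_space} set"
  assumes A: "A \<noteq> {}" "convex A" "closed A" and \<alpha>: "\<alpha> \<in> {0..1}"
  shows "norm (relaxed_proj \<alpha> A x - relaxed_proj \<alpha> A y) \<le> norm (x - y)"
proof -
  have "relaxed_proj \<alpha> A x - relaxed_proj \<alpha> A y
      = \<alpha> *\<^sub>R (metric_proj A x - metric_proj A y) + (1 - \<alpha>) *\<^sub>R (x - y)"
    by (simp add: relaxed_proj_def algebra_simps)
  also have "norm \<dots> \<le> \<alpha> * norm (metric_proj A x - metric_proj A y) + (1 - \<alpha>) * norm (x - y)"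
    using \<alpha> by (intro order_trans[OF norm_triangle_ineq]) simp
  also have "\<dots> \<le> \<alpha> * norm (x - y) + (1 - \<alpha>) * norm (x - y)"
    using \<alpha> metric_proj_nonexpansive[OF A] by (intro add_right_mono mult_left_mono) auto
  finally show ?thesis by (simp add: algebra_simps)
qed

lemma relaxed_comp_nonexpansive:
  assumes "\<forall>i\<in>{1..k}. A i \<noteq> {} \<and> convex (A i) \<and> closed (A i)" "\<alpha> \<in> {0..1}"
  shows "norm (relaxed_comp \<alpha> A k x - relaxed_comp \<alpha> A k y) \<le> norm (x - y)"
  using assms(1)
proof (induction k)
  case (Suc k)
  then have "norm (relaxed_comp \<alpha> A (Suc k) x - relaxed_comp \<alpha> A (Suc k) y)
      \<le> norm (relaxed_comp \<alpha> A k x - relaxed_comp \<alpha> A k y)"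
    using assms(2) by (auto intro!: relaxed_proj_nonexpansive)
  with Suc show ?case by fastforce
qed simp

text \<open>Changing the parameter of one relaxed projection moves the image in proportion to the
  distance from the set, which is bounded on bounded sets. The bound \<open>B\<close> is carried
  through the induction to control this distance at every stage.\<close>

lemma relaxed_comp_lipschitz_parameter:
  assumes "\<forall>i\<in>{1..k}. A i \<noteq> {} \<and> convex (A i) \<and> closed (A i)"
  obtains B C where "\<And>\<alpha> x. \<alpha> \<in> {0..1} \<Longrightarrow> norm x \<le> R \<Longrightarrow> norm (relaxed_comp \<alpha> A k x) \<le> B"
    and "\<And>\<alpha> \<beta> x. \<alpha> \<in> {0..1} \<Longrightarrow> \<beta> \<in> {0..1} \<Longrightarrow> norm x \<le> R \<Longrightarrow>
      norm (relaxed_comp \<alpha> A k x - relaxed_comp \<beta> A k x) \<le> C * \<bar>\<alpha> - \<beta>\<bar>"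
  using assms
proof (induction k arbitrary: thesis)
  case 0
  show ?case by (rule "0.prems"(1)[of R 0]) auto
next
  case (Suc k)
  have prem: "\<forall>i\<in>{1..k}. A i \<noteq> {} \<and> convex (A i) \<and> closed (A i)" using Suc.prems(2) by auto
  obtain B C where B: "\<And>\<alpha> x. \<alpha> \<in> {0..1} \<Longrightarrow> norm x \<le> R \<Longrightarrow> norm (relaxed_comp \<alpha> A k x) \<le> B"
    and C: "\<And>\<alpha> \<beta> x. \<alpha> \<in> {0..1} \<Longrightarrow> \<beta> \<in> {0..1} \<Longrightarrow> norm x \<le> R \<Longrightarrow>
      norm (relaxed_comp \<alpha> A k x - relaxed_comp \<beta> A k x) \<le> C * \<bar>\<alpha> - \<beta>\<bar>"
    using Suc.IH[OF _ prem] by blast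
  define D where "D = A (Suc k)"
  have D: "D \<noteq> {}" "convex D" "closed D" using Suc.prems(2) by (auto simp: D_def)
  obtain d where d: "d \<in> D" using D by auto
  define M where "M = B + norm d"
  have step: "norm (metric_proj D u - u) \<le> M" if "norm u \<le> B" for u
    using metric_proj_le[OF D d, of u] norm_triangle_ineq4[of u d] that
    by (simp add: M_def dist_norm norm_minus_commute)
  have rel: "relaxed_proj \<alpha> D u = u + \<alpha> *\<^sub>R (metric_proj D u - u)" for \<alpha> u
    by (simp add: relaxed_proj_def algebra_simps)
  show ?case
  proof (rule Suc.prems(1)[of "B + M" "C + M"])
    fix \<alpha> :: real and x :: 'a assume \<alpha>: "\<alpha> \<in> {0..1}" and x: "norm x \<le> R"
    define u where "u = relaxed_comp \<alpha> A k x"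
    have u: "norm u \<le> B" using B \<alpha> x by (simp add: u_def)
    have "norm (\<alpha> *\<^sub>R (metric_proj D u - u)) \<le> 1 * M"
      unfolding norm_scaleR using \<alpha> step[OF u] by (intro mult_mono) auto
    then show "norm (relaxed_comp \<alpha> A (Suc k) x) \<le> B + M"
      using norm_triangle_ineq[of u "\<alpha> *\<^sub>R (metric_proj D u - u)"] u
      by (simp add: u_def[symmetric] D_def[symmetric] rel)
  next
    fix \<alpha> \<beta> :: real and x :: 'a
    assume \<alpha>: "\<alpha> \<in> {0..1}" and \<beta>: "\<beta> \<in> {0..1}" and x: "norm x \<le> R"
    define u v where "u = relaxed_comp \<alpha> A k x" and "v = relaxed_comp \<beta> A k x"
    have v: "norm v \<le> B" using B \<beta> x by (simp add: v_def)
    \<comment> \<open>The change is split: first the argument changes at fixed \<alpha>, then the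
      parameter at fixed \<open>v\<close>.\<close>
    have "norm (relaxed_proj \<alpha> D u - relaxed_proj \<alpha> D v) \<le> C * \<bar>\<alpha> - \<beta>\<bar>"
      using relaxed_proj_nonexpansive[OF D \<alpha>, of u v] C[OF \<alpha> \<beta> x] by (simp add: u_def v_def)
    moreover have "relaxed_proj \<alpha> D v - relaxed_proj \<beta> D v = (\<alpha> - \<beta>) *\<^sub>R (metric_proj D v - v)"
      by (simp add: rel algebra_simps)
    then have "norm (relaxed_proj \<alpha> D v - relaxed_proj \<beta> D v) \<le> M * \<bar>\<alpha> - \<beta>\<bar>"
      using step[OF v] by (simp add: mult_left_mono mult.commute[of M])
    ultimately have "norm (relaxed_proj \<alpha> D u - relaxed_proj \<beta> D v) \<le> (C + M) * \<bar>\<alpha> - \<beta>\<bar>"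
      using norm_triangle_ineq[of "relaxed_proj \<alpha> D u - relaxed_proj \<alpha> D v"
          "relaxed_proj \<alpha> D v - relaxed_proj \<beta> D v"]
      by (simp add: algebra_simps)
    then show "norm (relaxed_comp \<alpha> A (Suc k) x - relaxed_comp \<beta> A (Suc k) x) \<le> (C + M) * \<bar>\<alpha> - \<beta>\<bar>"
      by (simp add: u_def v_def D_def)
  qed
qed

section \<open>Asymptotic centres\<close>

text \<open>The asymptotic centre \<open>c\<close> is the unique minimiser of the asymptotic radius
  \<open>f\<close>. Nonexpansiveness and the vanishing displacements give
  \<open>f (T c) \<le> f c\<close>, so \<open>T c\<close> is the centre as well.\<close>

lemma approximate_fixed_points_imp_fixed_point:
  fixes T :: "'a::{real_inner,complete_space} \<Rightarrow> 'a"
  assumes T: "\<And>x y. norm (T x - T y) \<le> norm (x - y)"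
    and bdd: "\<And>n. norm (X n) \<le> R"
    and lim: "(\<lambda>n. T (X n) - X n) \<longlonglongrightarrow> 0"
  obtains c where "T c = c"
proof -
  text \<open>\<open>f y\<close> is the limit superior of \<open>norm (X n - y)\<close>.\<close>
  define S where "S y = {r. r \<ge> 0 \<and> (\<forall>\<^sub>F n in sequentially. norm (X n - y) \<le> r)}" for y
  define f where "f y = Inf (S y)" for y
  have bS: "bdd_below (S y)" for y by (rule bdd_belowI[of _ 0]) (auto simp: S_def)
  have neS: "S y \<noteq> {}" for y
  proof -
    have "norm (X n - y) \<le> R + norm y" for n
      using norm_triangle_ineq4[of "X n" y] bdd[of n] by linarith
    moreover have "0 \<le> R + norm y"
      using bdd[of 0] norm_ge_zero[of "X 0"] norm_ge_zero[of y] by linarith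
    ultimately have "R + norm y \<in> S y" by (simp add: S_def)
    then show ?thesis by blast
  qed
  have f_le: "f y \<le> r" if "r \<ge> 0" "\<forall>\<^sub>F n in sequentially. norm (X n - y) \<le> r" for y r
    unfolding f_def using that bS by (intro cInf_lower) (auto simp: S_def)
  have f_nn: "f y \<ge> 0" for y
    unfolding f_def by (rule cInf_greatest[OF neS]) (auto simp: S_def)
  have f_ev: "\<forall>\<^sub>F n in sequentially. norm (X n - y) \<le> f y + e" if "e > 0" for y e
  proof -
    have "Inf (S y) < f y + e" using that by (simp add: f_def)
    then obtain r where "r \<in> S y" "r < f y + e"
      using cInf_lessD[OF neS] by blast
    then show ?thesis by (auto simp: S_def elim: eventually_mono)
  qed
  have f_lip: "f y \<le> f z + norm (z - y)" for y z
  proof (rule field_le_epsilon)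
    fix e :: real assume "e > 0"
    have "\<forall>\<^sub>F n in sequentially. norm (X n - y) \<le> f z + norm (z - y) + e"
      using f_ev[OF \<open>e > 0\<close>, of z]
    proof eventually_elim
      case (elim n)
      then show ?case using norm_triangle_ineq[of "X n - z" "z - y"] by simp
    qed
    then show "f y \<le> f z + norm (z - y) + e"
      using f_nn[of z] \<open>e > 0\<close> by (intro f_le) auto
  qed
  have cont: "continuous_on UNIV f"
    unfolding continuous_on_iff
  proof (intro ballI allI impI)
    fix x and e :: real assume "e > 0"
    have "dist (f y) (f x) < e" if "dist y x < e" for y
      using f_lip[of x y] f_lip[of y x] that by (simp add: dist_norm norm_minus_commute)
    then show "\<exists>d>0. \<forall>y\<in>UNIV. dist y x < d \<longrightarrow> dist (f y) (f x) < e"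
      using \<open>e > 0\<close> by blast
  qed
  \<comment> \<open>The parallelogram identity is applied to each late \<open>X n\<close> with slack
    \<open>e\<close>; then \<open>e\<close> tends to 0.\<close>
  have mid: "(f (midpoint x y))\<^sup>2 \<le> ((f x)\<^sup>2 + (f y)\<^sup>2) / 2 - (norm (x - y))\<^sup>2 / 4" for x y
  proof -
    define q where "q e = ((f x + e)\<^sup>2 + (f y + e)\<^sup>2) / 2 - (norm (x - y))\<^sup>2 / 4" for e
    have "(f (midpoint x y))\<^sup>2 \<le> q e" if "e > 0" for e
    proof -
      have ev: "\<forall>\<^sub>F n in sequentially. (norm (X n - midpoint x y))\<^sup>2 \<le> q e"
        using f_ev[OF that, of x] f_ev[OF that, of y]
      proof eventually_elim
        case (elim n)
        then have "(norm (X n - x))\<^sup>2 \<le> (f x + e)\<^sup>2" "(norm (X n - y))\<^sup>2 \<le> (f y + e)\<^sup>2"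
          by (auto intro: power_mono)
        then show ?case by (simp add: parallelogram_midpoint q_def)
      qed
      then obtain n where "(norm (X n - midpoint x y))\<^sup>2 \<le> q e"
        by (auto simp: eventually_sequentially)
      then have qnn: "q e \<ge> 0" using zero_le_power2 order_trans by blast
      from ev have "\<forall>\<^sub>F n in sequentially. norm (X n - midpoint x y) \<le> sqrt (q e)"
        by eventually_elim (rule real_le_rsqrt)
      then have "f (midpoint x y) \<le> sqrt (q e)" using qnn by (intro f_le) auto
      then have "(f (midpoint x y))\<^sup>2 \<le> (sqrt (q e))\<^sup>2" using f_nn by (intro power_mono)
      then show ?thesis using qnn by simp
    qed
    then have "\<forall>\<^sub>F e in at_right 0. (f (midpoint x y))\<^sup>2 \<le> q e"
      by (simp add: eventually_at_filter)
    moreover have "(q \<longlongrightarrow> q 0) (at_right 0)"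
      unfolding q_def by (intro tendsto_intros) auto
    ultimately have "(f (midpoint x y))\<^sup>2 \<le> q 0"
      by (intro tendsto_lowerbound[of q "q 0" "at_right 0"]) auto
    then show ?thesis by (simp add: q_def)
  qed
  obtain c where c: "\<And>y. f y \<le> f c \<Longrightarrow> y = c"
    using uniformly_convex_minimiser[of UNIV f, OF _ _ _ cont f_nn mid] by (metis UNIV_I UNIV_not_empty closed_UNIV convex_UNIV)
  have "f (T c) \<le> f c"
  proof (rule field_le_epsilon)
    fix e :: real assume "e > 0"
    have "\<forall>\<^sub>F n in sequentially. dist (T (X n) - X n) 0 < e / 2"
      using lim \<open>e > 0\<close> by (intro tendstoD) auto
    then have "\<forall>\<^sub>F n in sequentially. norm (X n - T c) \<le> f c + e"
      using f_ev[OF half_gt_zero[OF \<open>e > 0\<close>], of c]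
    proof eventually_elim
      case (elim n)
      have "norm (X n - T c) \<le> norm (T (X n) - X n) + norm (T (X n) - T c)"
        using norm_triangle_ineq4[of "T (X n) - T c" "T (X n) - X n"] by (simp add: algebra_simps)
      with elim T[of "X n" c] show ?case by simp
    qed
    then show "f (T c) \<le> f c + e"
      using f_nn[of c] \<open>e > 0\<close> by (intro f_le) auto
  qed
  then have "T c = c" by (rule c)
  then show ?thesis by (rule that)
qed

text \<open>The asymptotic centre comes without the norm bound \<open>n\<close>, so the argument
  shows that the closure of \<open>E n\<close> stays inside the whole parameter set. That suffices
  to write the set as the union of these closures.\<close>

lemma fixed_point_parameters_fsigma:
  assumes A: "\<forall>i\<in>{1..k}. A i \<noteq> {} \<and> convex (A i) \<and> closed (A i)"
  shows "fsigma_in (top_of_set {0..1}) {\<alpha> \<in> {0..1}. \<exists>x. relaxed_comp \<alpha> A k x = x}"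
    (is "fsigma_in _ ?F")
proof -
  define E where "E n = {\<alpha> \<in> {0..1}. \<exists>x. norm x \<le> real n \<and> relaxed_comp \<alpha> A k x = x}" for n
  have E01: "closure (E n) \<subseteq> {0..1}" for n
    by (rule closure_minimal) (auto simp: E_def)
  have sub: "closure (E n) \<subseteq> ?F" for n
  proof
    fix \<alpha> assume "\<alpha> \<in> closure (E n)"
    then obtain a where a: "\<And>j. a j \<in> E n" "a \<longlonglongrightarrow> \<alpha>"
      unfolding closure_sequential by blast
    have \<alpha>: "\<alpha> \<in> {0..1}" using E01 \<open>\<alpha> \<in> closure (E n)\<close> by blast
    obtain X where X: "\<And>j. norm (X j) \<le> real n" "\<And>j. relaxed_comp (a j) A k (X j) = X j"
      using a(1) unfolding E_def by (simp add: mem_Collect_eq) metis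
    have a01: "a j \<in> {0..1}" for j using a(1)[of j] by (simp add: E_def)
    obtain C where C: "\<And>\<alpha> \<beta> x. \<alpha> \<in> {0..1} \<Longrightarrow> \<beta> \<in> {0..1} \<Longrightarrow> norm x \<le> real n \<Longrightarrow>
        norm (relaxed_comp \<alpha> A k x - relaxed_comp \<beta> A k x) \<le> C * \<bar>\<alpha> - \<beta>\<bar>"
      by (rule relaxed_comp_lipschitz_parameter[OF A, of "real n"]) blast
    have "(\<lambda>j. C * \<bar>\<alpha> - a j\<bar>) \<longlonglongrightarrow> C * \<bar>\<alpha> - \<alpha>\<bar>"
      by (intro tendsto_intros a(2))
    then have "(\<lambda>j. C * \<bar>\<alpha> - a j\<bar>) \<longlonglongrightarrow> 0" by simp
    \<comment> \<open>\<open>X j\<close> is fixed for the parameter \<open>a j\<close>; passing to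
      \<alpha> costs only the Lipschitz error.\<close>
    moreover have "norm (relaxed_comp \<alpha> A k (X j) - X j) \<le> C * \<bar>\<alpha> - a j\<bar>" for j
      using C[OF \<alpha> a01[of j] X(1)[of j]] X(2)[of j] by simp
    ultimately have "(\<lambda>j. relaxed_comp \<alpha> A k (X j) - X j) \<longlonglongrightarrow> 0"
      by (rule Lim_null_comparison[OF always_eventually[OF allI], rotated])
    then obtain c where "relaxed_comp \<alpha> A k c = c"
      using approximate_fixed_points_imp_fixed_point[of "relaxed_comp \<alpha> A k" X "real n"]
        relaxed_comp_nonexpansive[OF A \<alpha>] X(1) by blast
    then show "\<alpha> \<in> ?F" using \<alpha> by blast
  qed
  have "?F \<subseteq> (\<Union>n. closure (E n))"
  proof
    fix \<alpha> assume "\<alpha> \<in> ?F"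
    then obtain x where "\<alpha> \<in> {0..1}" "relaxed_comp \<alpha> A k x = x" by blast
    moreover obtain n where "norm x \<le> real n" using real_arch_simple by blast
    ultimately have "\<alpha> \<in> E n" by (auto simp: E_def)
    then show "\<alpha> \<in> (\<Union>n. closure (E n))" using closure_subset by blast
  qed
  then have "?F = (\<Union>n. closure (E n))" using sub by blast
  moreover have "fsigma_in (top_of_set {0..1}) (\<Union> (range (\<lambda>n. closure (E n))))"
    by (rule fsigma_in_Union)
      (auto intro!: closed_imp_fsigma_in closed_subset simp: E01 del: subsetI)
  ultimately show ?thesis by simp
qed

section \<open>A convex set with prescribed shadow\<close>

lemma orthonormal_triple:
  assumes "\<exists>S :: 'a::real_inner set. independent S \<and> finite S \<and> card S = 3"
  obtains e1 e2 e3 :: "'a::real_inner" where "norm e1 = 1" "norm e2 = 1" "norm e3 = 1"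
    "e1 \<bullet> e2 = 0" "e1 \<bullet> e3 = 0" "e2 \<bullet> e3 = 0"
proof -
  obtain S :: "'a set" where S: "independent S" "finite S" "card S = 3" using assms by blast
  obtain C where C: "finite C" "card C \<le> card S" "span C = span S" "pairwise orthogonal C"
    using basis_orthogonal[OF S(2)] by blast
  \<comment> \<open>Removing 0 keeps the span, so three independent vectors force at least three
    nonzero orthogonal ones, which can then be normalised.\<close>
  have "card S \<le> card (C - {0})"
    using C(1,3) S(1) independent_span_bound[of "C - {0}" S]
    by (simp add: span_superset)
  moreover have "card (C - {0}) \<le> card C" using C(1) by (intro card_mono) auto
  ultimately have card: "card (C - {0}) = 3" using C(2) S(3) by linarith
  obtain a b c where abc: "C - {0} = {a, b, c}" "a \<noteq> b" "a \<noteq> c" "b \<noteq> c"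
    using card by (auto simp: card_3_iff)
  have nz: "a \<noteq> 0" "b \<noteq> 0" "c \<noteq> 0" and inC: "a \<in> C" "b \<in> C" "c \<in> C" using abc(1) by auto
  have "a \<bullet> b = 0" "a \<bullet> c = 0" "b \<bullet> c = 0"
    using C(4) inC abc unfolding pairwise_def orthogonal_def by blast+
  then show ?thesis
    using nz by (intro that[of "sgn a" "sgn b" "sgn c"]) (auto simp: sgn_div_norm norm_sgn)
qed

locale orthonormal_frame =
  fixes e1 e2 e3 :: "'a::{real_inner,complete_space}"
  assumes unit: "norm e1 = 1" "norm e2 = 1" "norm e3 = 1"
    and orth: "e1 \<bullet> e2 = 0" "e1 \<bullet> e3 = 0" "e2 \<bullet> e3 = 0"
begin

text \<open>The orthogonal projection onto the plane, kept as a map of the space into itself so that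
  planar parts and full vectors can be combined.\<close>

definition shadow :: "'a \<Rightarrow> 'a" where
  "shadow x = (x \<bullet> e1) *\<^sub>R e1 + (x \<bullet> e2) *\<^sub>R e2"

lemma inner_frame [simp]:
  "e1 \<bullet> e1 = 1" "e2 \<bullet> e2 = 1" "e3 \<bullet> e3 = 1"
  "e1 \<bullet> e2 = 0" "e1 \<bullet> e3 = 0" "e2 \<bullet> e3 = 0"
  "e2 \<bullet> e1 = 0" "e3 \<bullet> e1 = 0" "e3 \<bullet> e2 = 0"
  using unit orth by (simp_all add: norm_eq_1 inner_commute)

lemma shadow_simps [simp]:
  "shadow (x + y) = shadow x + shadow y"
  "shadow (x - y) = shadow x - shadow y"
  "shadow (c *\<^sub>R x) = c *\<^sub>R shadow x"
  "shadow (shadow x) = shadow x"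
  "shadow e1 = e1" "shadow e2 = e2" "shadow e3 = 0"
  by (simp_all add: shadow_def algebra_simps)

lemma shadow_inner_swap: "shadow x \<bullet> y = x \<bullet> shadow y"
  by (simp add: shadow_def algebra_simps inner_commute)

lemma shadow_inner_e3 [simp]: "shadow x \<bullet> e3 = 0"
  by (simp add: shadow_inner_swap)

lemma continuous_shadow: "continuous_on S shadow"
  unfolding shadow_def by (intro continuous_intros)

text \<open>The set is the epigraph, over the unit disc, of a supremum of affine functions of height
  \<open>n\<close> at \<open>g \<alpha>\<close>, for \<open>\<alpha> \<notin> F\<close> and \<open>n\<in>\<nat>\<close>. The slopes \<open>c n \<alpha>\<close> are so steep that the \<open>n\<close>-th function
  is negative on \<open>g ` K n\<close>, where \<open>K n\<close> increases to \<open>F\<close>; slopes at least \<open>n\<^sup>2\<close> keep the supremum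
  finite inside the disc.\<close>
lemma convex_set_with_fsigma_shadow:
  fixes g :: "real \<Rightarrow> 'a"
  assumes F: "fsigma_in (top_of_set {0..1}) F"
    and cont: "continuous_on {0..1} g" and inj: "inj_on g {0..1}"
    and g1: "\<And>\<alpha>. \<alpha> \<in> {0..1} \<Longrightarrow> norm (g \<alpha>) = 1"
    and gQ: "\<And>\<alpha>. \<alpha> \<in> {0..1} \<Longrightarrow> shadow (g \<alpha>) = g \<alpha>"
  obtains C where "convex C" "closed C" "\<And>x. x \<in> C \<Longrightarrow> norm (shadow x) \<le> 1"
    "\<And>y. norm (shadow y) < 1 \<Longrightarrow> \<exists>x\<in>C. shadow x = shadow y"
    "\<And>\<alpha>. \<alpha> \<in> F \<Longrightarrow> \<exists>x\<in>C. shadow x = g \<alpha>"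
    "\<And>\<alpha> x. \<alpha> \<in> {0..1} - F \<Longrightarrow> x \<in> C \<Longrightarrow> shadow x \<noteq> g \<alpha>"
proof -
  obtain K where K: "\<And>n. closedin (top_of_set {0..1}) (K n)" "\<And>n. K n \<subseteq> K (Suc n)" "\<Union> (range K) = F"
    using F unfolding fsigma_in_ascending by blast
  have Ksub: "K n \<subseteq> {0..1}" for n using closedin_imp_subset[OF K(1)] .
  have Kcpt: "compact (K n)" for n
    using closedin_compact[OF compact_Icc K(1)] .
  have Kmono: "K m \<subseteq> K n" if "m \<le> n" for m n
    using lift_Suc_mono_le[of K, OF K(2) that] .
  \<comment> \<open>By injectivity these are distinct unit vectors, so Cauchy-Schwarz is
    strict.\<close>
  have inner_less: "g \<alpha> \<bullet> g \<beta> < 1" if "\<alpha> \<in> {0..1}" "\<beta> \<in> {0..1}" "\<alpha> \<noteq> \<beta>" for \<alpha> \<beta>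
  proof -
    have "g \<alpha> - g \<beta> \<noteq> 0" using that inj by (auto dest: inj_onD)
    then have "0 < (norm (g \<alpha> - g \<beta>))\<^sup>2" by simp
    also have "\<dots> = 2 - 2 * (g \<alpha> \<bullet> g \<beta>)"
      using g1[OF that(1)] g1[OF that(2)] unfolding power2_norm_eq_inner norm_eq_1
      by (simp add: algebra_simps inner_commute)
    finally show ?thesis by simp
  qed
  define steep where "steep n \<alpha> c \<longleftrightarrow>
    c \<ge> (real n)\<^sup>2 \<and> (\<forall>\<beta>\<in>K n. real n - c * (1 - g \<alpha> \<bullet> g \<beta>) \<le> 0)" for n \<alpha> c
  \<comment> \<open>\<alpha> lies outside the compact set \<open>K n\<close>, so
    \<open>1 - g \<alpha> \<bullet> g \<beta>\<close> is bounded away from 0 there and one slope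
    serves all \<beta>.\<close>
  have ex_steep: "\<exists>c. steep n \<alpha> c"
    if \<alpha>: "\<alpha> \<in> {0..1} - F" for n \<alpha>
  proof -
    have "compact ((\<lambda>\<beta>. real n / (1 - g \<alpha> \<bullet> g \<beta>)) ` K n)"
    proof (rule compact_continuous_image[OF _ Kcpt])
      have "1 - g \<alpha> \<bullet> g \<beta> \<noteq> 0" if "\<beta> \<in> K n" for \<beta>
        using inner_less[of \<alpha> \<beta>] \<alpha> that Ksub K(3) by force
      then show "continuous_on (K n) (\<lambda>\<beta>. real n / (1 - g \<alpha> \<bullet> g \<beta>))"
        by (intro continuous_intros continuous_on_subset[OF cont Ksub]) auto
    qed
    then have "bdd_above ((\<lambda>\<beta>. real n / (1 - g \<alpha> \<bullet> g \<beta>)) ` K n)"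
      by (intro bounded_imp_bdd_above compact_imp_bounded)
    then obtain M where M: "\<And>\<beta>. \<beta> \<in> K n \<Longrightarrow> real n / (1 - g \<alpha> \<bullet> g \<beta>) \<le> M"
      unfolding bdd_above_def by blast
    have "real n - max M ((real n)\<^sup>2) * (1 - g \<alpha> \<bullet> g \<beta>) \<le> 0" if "\<beta> \<in> K n" for \<beta>
    proof -
      have pos: "0 < 1 - g \<alpha> \<bullet> g \<beta>"
        using inner_less[of \<alpha> \<beta>] \<alpha> that Ksub K(3) by force
      have "real n \<le> M * (1 - g \<alpha> \<bullet> g \<beta>)"
        using M[OF that] pos by (simp add: pos_divide_le_eq)
      also have "\<dots> \<le> max M ((real n)\<^sup>2) * (1 - g \<alpha> \<bullet> g \<beta>)"
        using pos by (intro mult_right_mono) auto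
      finally show ?thesis by simp
    qed
    then have "steep n \<alpha> (max M ((real n)\<^sup>2))" by (simp add: steep_def)
    then show ?thesis ..
  qed
  define c where "c n \<alpha> = (SOME c. steep n \<alpha> c)" for n \<alpha>
  have "steep n \<alpha> (c n \<alpha>)" if "\<alpha> \<in> {0..1} - F" for n \<alpha>
    unfolding c_def using ex_steep[OF that] by (rule someI_ex)
  then have c: "\<And>n \<alpha>. \<alpha> \<in> {0..1} - F \<Longrightarrow> c n \<alpha> \<ge> (real n)\<^sup>2"
      "\<And>n \<alpha> \<beta>. \<alpha> \<in> {0..1} - F \<Longrightarrow> \<beta> \<in> K n \<Longrightarrow> real n - c n \<alpha> * (1 - g \<alpha> \<bullet> g \<beta>) \<le> 0"
    unfolding steep_def by blast+
  \<comment> \<open>Each epigraph condition is written as a half-space, which makes \<open>C\<close>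
    visibly closed and convex; \<open>C_iff\<close> restores the epigraph form.\<close>
  define C where "C = {x. norm (shadow x) \<le> 1} \<inter>
    (\<Inter>\<alpha>\<in>{0..1} - F. \<Inter>n. {x. (c n \<alpha> *\<^sub>R g \<alpha> - e3) \<bullet> x \<le> c n \<alpha> - real n})"
  have C_iff: "x \<in> C \<longleftrightarrow> norm (shadow x) \<le> 1 \<and>
      (\<forall>\<alpha>\<in>{0..1} - F. \<forall>n. real n - c n \<alpha> * (1 - g \<alpha> \<bullet> shadow x) \<le> x \<bullet> e3)" for x
  proof -
    have "(c n \<alpha> *\<^sub>R g \<alpha> - e3) \<bullet> x \<le> c n \<alpha> - real n \<longleftrightarrow>
        real n - c n \<alpha> * (1 - g \<alpha> \<bullet> shadow x) \<le> x \<bullet> e3" if "\<alpha> \<in> {0..1}" for n \<alpha>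
      using gQ[OF that] shadow_inner_swap[of "g \<alpha>" x]
      by (simp add: inner_diff_left inner_commute[of e3] algebra_simps)
    then show ?thesis by (simp add: C_def)
  qed
  have cnn: "c n \<alpha> \<ge> 0" if "\<alpha> \<in> {0..1} - F" for n \<alpha>
    using c(1)[OF that] zero_le_power2 order_trans by blast
  show ?thesis
  proof (rule that[of C])
    have "convex {x. norm (shadow x) \<le> 1}"
    proof (rule convexI)
      fix x y and u v :: real
      assume *: "x \<in> {x. norm (shadow x) \<le> 1}" "y \<in> {x. norm (shadow x) \<le> 1}"
        "0 \<le> u" "0 \<le> v" "u + v = 1"
      have "norm (u *\<^sub>R shadow x + v *\<^sub>R shadow y) \<le> u * norm (shadow x) + v * norm (shadow y)"
        using * by (intro order_trans[OF norm_triangle_ineq]) simp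
      also have "\<dots> \<le> 1" using * by (intro convex_bound_le) auto
      finally show "u *\<^sub>R x + v *\<^sub>R y \<in> {x. norm (shadow x) \<le> 1}" by simp
    qed
    then show "convex C"
      unfolding C_def by (intro convex_Int convex_INT convex_halfspace_le)
    show "closed C"
      unfolding C_def
      by (intro closed_Int closed_INT ballI closed_halfspace_le closed_Collect_le
          continuous_intros continuous_shadow)
    show "norm (shadow x) \<le> 1" if "x \<in> C" for x using that C_iff by blast
  next
    fix y assume y: "norm (shadow y) < 1"
    define h where "h = 1 - norm (shadow y)"
    have h: "h > 0" using y by (simp add: h_def)
    \<comment> \<open>At depth \<open>h\<close> inside the disc the \<open>n\<close>-th function is
      at most \<open>n - n^2 * h\<close>, whose maximum over real \<open>n\<close> is
      \<open>1 / (4 * h)\<close>.\<close>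
    define x where "x = shadow y + (1 / (4 * h)) *\<^sub>R e3"
    have "real n - c n \<alpha> * (1 - g \<alpha> \<bullet> shadow y) \<le> 1 / (4 * h)" if \<alpha>: "\<alpha> \<in> {0..1} - F" for n \<alpha>
    proof -
      have "g \<alpha> \<bullet> shadow y \<le> norm (shadow y)"
        using norm_cauchy_schwarz[of "g \<alpha>" "shadow y"] g1 \<alpha> by simp
      then have "(real n)\<^sup>2 * h \<le> c n \<alpha> * (1 - g \<alpha> \<bullet> shadow y)"
        using c(1)[OF \<alpha>] cnn[OF \<alpha>] h by (intro mult_mono) (auto simp: h_def)
      moreover have "real n - (real n)\<^sup>2 * h \<le> 1 / (4 * h)"
      proof -
        have "0 \<le> (2 * h * real n - 1)\<^sup>2 / (4 * h)" using h by simp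
        also have "\<dots> = (real n)\<^sup>2 * h - real n + 1 / (4 * h)"
          using h by (simp add: power2_eq_square field_simps)
        finally show ?thesis by simp
      qed
      ultimately show ?thesis by linarith
    qed
    then have "x \<in> C" unfolding C_iff using y by (simp add: x_def inner_add_left)
    moreover have "shadow x = shadow y" by (simp add: x_def)
    ultimately show "\<exists>x\<in>C. shadow x = shadow y" by blast
  next
    fix \<alpha> assume "\<alpha> \<in> F"
    then obtain m where m: "\<alpha> \<in> K m" using K(3) by blast
    have \<alpha>: "\<alpha> \<in> {0..1}" using m Ksub by blast
    \<comment> \<open>Height \<open>m\<close> suffices: functions with \<open>n \<le> m\<close>
      never exceed \<open>n\<close> on the disc, and those with \<open>n > m\<close> are nonpositive
      at \<open>g \<alpha>\<close> because \<alpha> lies in \<open>K n\<close>.\<close>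
    define x where "x = g \<alpha> + real m *\<^sub>R e3"
    have sx: "shadow x = g \<alpha>" using gQ[OF \<alpha>] by (simp add: x_def)
    have "real n - c n \<beta> * (1 - g \<beta> \<bullet> g \<alpha>) \<le> real m" if \<beta>: "\<beta> \<in> {0..1} - F" for n \<beta>
    proof (cases "n \<le> m")
      case True
      have "g \<beta> \<bullet> g \<alpha> \<le> 1"
        using norm_cauchy_schwarz[of "g \<beta>" "g \<alpha>"] g1 \<alpha> \<beta> by simp
      then have "0 \<le> c n \<beta> * (1 - g \<beta> \<bullet> g \<alpha>)" using cnn[OF \<beta>] by simp
      with True show ?thesis by simp
    next
      case False
      then have "\<alpha> \<in> K n" using m Kmono[of m n] by auto
      then show ?thesis using c(2)[OF \<beta>] by (meson of_nat_0_le_iff order_trans)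
    qed
    moreover have "x \<bullet> e3 = real m"
      using gQ[OF \<alpha>] shadow_inner_e3[of "g \<alpha>"] by (simp add: x_def inner_add_left)
    ultimately have "x \<in> C" unfolding C_iff sx using g1[OF \<alpha>] by simp
    then show "\<exists>x\<in>C. shadow x = g \<alpha>" using sx by blast
  next
    fix \<alpha> x assume \<alpha>: "\<alpha> \<in> {0..1} - F" and x: "x \<in> C"
    show "shadow x \<noteq> g \<alpha>"
    proof
      assume sx: "shadow x = g \<alpha>"
      \<comment> \<open>The functions attached to \<alpha> itself take every value \<open>n\<close>
        here, so the \<open>e3\<close>-coordinate of \<open>x\<close> would exceed all
        naturals.\<close>
      have "g \<alpha> \<bullet> g \<alpha> = 1" using g1[of \<alpha>] \<alpha> by (simp add: norm_eq_1)
      then have "real n \<le> x \<bullet> e3" for n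
        using x \<alpha> unfolding C_iff sx by force
      then show False using reals_Archimedean2[of "x \<bullet> e3"] not_le by blast
    qed
  qed
qed

section \<open>Relaxed cycles over the disc\<close>

lemma fibre_closed_convex:
  "{x. shadow x = p} \<noteq> {}" "convex {x. shadow x = p}" "closed {x. shadow x = p}" if "shadow p = p"
proof -
  show "{x. shadow x = p} \<noteq> {}" using that by blast
  show "closed {x. shadow x = p}"
    by (intro closed_Collect_eq continuous_shadow continuous_intros)
  show "convex {x. shadow x = p}"
    by (rule convexI) (simp add: scaleR_left_distrib[symmetric])
qed

text \<open>The planar displacement \<open>p - shadow x\<close> is orthogonal to the fibre, so the
  projection is a translation by it.\<close>

lemma relaxed_proj_fibre:
  assumes "shadow p = p"
  shows "relaxed_proj \<alpha> {x. shadow x = p} x = x + \<alpha> *\<^sub>R (p - shadow x)"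
proof -
  have eq: "metric_proj {x. shadow x = p} x = x - shadow x + p"
  proof (rule metric_proj_unique)
    fix y assume "y \<in> {x. shadow x = p}"
    then have "(shadow x - p) \<bullet> (y - (x - shadow x + p)) = 0"
      using shadow_inner_swap[of "x - p" "y - (x - shadow x + p)"] assms by simp
    then show "(x - (x - shadow x + p)) \<bullet> (y - (x - shadow x + p)) \<le> 0" by simp
  qed (use fibre_closed_convex assms in auto)
  show ?thesis unfolding relaxed_proj_def eq by (simp add: algebra_simps)
qed

text \<open>The displacement \<open>d\<close> from \<open>w\<close> to \<open>z\<close> is planar,
  and the disc condition makes it an outward normal of the unit disc at \<open>shadow w\<close>. The
  cycle equation then makes \<open>v\<close> a positive multiple of \<open>shadow w\<close>, and
  \<open>large\<close> forces \<open>shadow w\<close> onto the circle.\<close>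

lemma fixed_cycle_shadow:
  assumes C: "C \<noteq> {}" "convex C" "closed C" "\<And>x. x \<in> C \<Longrightarrow> norm (shadow x) \<le> 1"
    and disc: "\<And>y. norm (shadow y) < 1 \<Longrightarrow> \<exists>x\<in>C. shadow x = shadow y"
    and \<alpha>: "0 < \<alpha>" "\<alpha> \<le> 1" and pq: "shadow p = p" "shadow q = q"
    and large: "norm ((1 - \<alpha>) *\<^sub>R p + q) > 2 - \<alpha>"
    and fixed: "relaxed_proj \<alpha> C (relaxed_proj \<alpha> {x. shadow x = q} (relaxed_proj \<alpha> {x. shadow x = p} x)) = x"
  shows "\<exists>w\<in>C. shadow w = sgn ((1 - \<alpha>) *\<^sub>R p + q)"
proof -
  define b where "b = 1 - \<alpha>"
  have ab: "\<alpha> = 1 - b" by (simp add: b_def)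
  define z where "z = relaxed_proj \<alpha> {x. shadow x = q} (relaxed_proj \<alpha> {x. shadow x = p} x)"
  define w where "w = metric_proj C z"
  define d where "d = shadow z - shadow w"
  define v where "v = b *\<^sub>R p + q"
  have wC: "w \<in> C" unfolding w_def by (rule metric_proj_in[OF C(1-3)])
  have z: "z = x - shadow x + (b\<^sup>2 *\<^sub>R shadow x + (\<alpha> * b) *\<^sub>R p + \<alpha> *\<^sub>R q)"
    using pq by (simp add: z_def relaxed_proj_fibre ab algebra_simps power2_eq_square)
  have "relaxed_proj \<alpha> C z = x" using fixed by (simp only: z_def)
  then have x: "x = \<alpha> *\<^sub>R w + b *\<^sub>R z"
    by (simp add: relaxed_proj_def w_def b_def)
  have sz: "shadow z = b\<^sup>2 *\<^sub>R shadow x + (\<alpha> * b) *\<^sub>R p + \<alpha> *\<^sub>R q"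
    using pq by (subst z) simp
  have "z - shadow z = x - shadow x" unfolding sz by (subst z) simp
  moreover have "x - shadow x = \<alpha> *\<^sub>R (w - shadow w) + b *\<^sub>R (z - shadow z)"
    by (subst (1 2) x) (simp add: algebra_simps)
  ultimately have "\<alpha> *\<^sub>R (z - shadow z) = \<alpha> *\<^sub>R (w - shadow w)"
    by (simp add: ab algebra_simps)
  \<comment> \<open>The fibre steps preserve the part orthogonal to the plane, so the last step must
    preserve it too; as \<alpha> is positive, \<open>z\<close> and \<open>w\<close> share
    it.\<close>
  then have vert: "z - shadow z = w - shadow w" using \<alpha> by simp
  have sx: "shadow x = \<alpha> *\<^sub>R shadow w + b *\<^sub>R shadow z" by (subst x) simp
  have "shadow z = \<alpha> *\<^sub>R (b\<^sup>2 *\<^sub>R shadow w + v) + b ^ 3 *\<^sub>R shadow z"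
    by (subst sz, subst sx) (simp add: v_def algebra_simps power2_eq_square power3_eq_cube)
  moreover have "1 - b ^ 3 = \<alpha> * (1 + b + b\<^sup>2)"
    by (simp add: ab algebra_simps power2_eq_square power3_eq_cube)
  ultimately have "\<alpha> *\<^sub>R ((1 + b + b\<^sup>2) *\<^sub>R shadow z) = \<alpha> *\<^sub>R (b\<^sup>2 *\<^sub>R shadow w + v)"
    by (metis add_diff_cancel_right' scaleR_left_diff_distrib scaleR_one scaleR_scaleR)
  then have cycle: "(1 + b + b\<^sup>2) *\<^sub>R shadow z = b\<^sup>2 *\<^sub>R shadow w + v"
    using \<alpha>(1) by (metis less_irrefl scaleR_left_imp_eq)
  have zw: "z - w = d" unfolding d_def using vert by (simp add: algebra_simps)
  have sd: "shadow d = d" by (simp add: d_def)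
  \<comment> \<open>The boundary point \<open>sgn d\<close> need not be in the shadow of
    \<open>C\<close>, so the variational inequality is tested at interior points
    \<open>r *\<^sub>R sgn d\<close>, and \<open>r\<close> tends to 1 afterwards.\<close>
  have var: "r * norm d \<le> d \<bullet> shadow w" if "0 \<le> r" "r < 1" for r
  proof -
    have sgn: "shadow (r *\<^sub>R sgn d) = r *\<^sub>R sgn d" by (simp add: sgn_div_norm sd)
    have "norm (shadow (r *\<^sub>R sgn d)) < 1" unfolding sgn using that by (simp add: norm_sgn)
    then obtain y where y: "y \<in> C" "shadow y = r *\<^sub>R sgn d"
      using disc sgn by metis
    have "d \<bullet> (y - w) \<le> 0"
      using metric_proj_variational[OF C(1-3) y(1), of z] by (simp add: w_def[symmetric] zw)
    then have "d \<bullet> shadow y \<le> d \<bullet> shadow w"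
      using sd shadow_inner_swap[of d y] shadow_inner_swap[of d w] by (simp add: inner_diff_right)
    moreover have "d \<bullet> sgn d = norm d"
      by (cases "d = 0") (simp_all add: sgn_div_norm power2_norm_eq_inner[symmetric] power2_eq_square)
    ultimately show ?thesis using y(2) by simp
  qed
  have dw: "norm d \<le> d \<bullet> shadow w"
  proof (rule field_le_mult_one_interval)
    fix r :: real assume "0 < r" "r < 1"
    then show "r * norm d \<le> d \<bullet> shadow w" using var by simp
  qed
  have w1: "norm (shadow w) \<le> 1" using C(4)[OF wC] .
  \<comment> \<open>Equality case of Cauchy-Schwarz: \<open>d\<close> pairs with
    \<open>shadow w\<close>, of norm at most 1, to at least \<open>norm d\<close>, so it points
    along \<open>shadow w\<close>.\<close>
  have "(norm (d - norm d *\<^sub>R shadow w))\<^sup>2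
      = d \<bullet> d - 2 * norm d * (d \<bullet> shadow w) + (norm d)\<^sup>2 * (shadow w \<bullet> shadow w)"
    unfolding power2_norm_eq_inner[of "d - norm d *\<^sub>R shadow w"]
    by (simp add: algebra_simps inner_commute power2_eq_square)
  also have "\<dots> = (norm d)\<^sup>2 - 2 * norm d * (d \<bullet> shadow w) + (norm d)\<^sup>2 * (norm (shadow w))\<^sup>2"
    by (simp only: dot_square_norm)
  also have "\<dots> \<le> (norm d)\<^sup>2 - 2 * norm d * norm d + (norm d)\<^sup>2 * 1"
    using dw w1 by (intro add_mono diff_mono mult_left_mono) (auto simp: power_le_one)
  also have "\<dots> = 0" by (simp add: power2_eq_square)
  finally have d: "d = norm d *\<^sub>R shadow w" by simp
  define t where "t = (1 + b + b\<^sup>2) * (1 + norm d) - b\<^sup>2"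
  have b01: "0 \<le> b" "b < 1" using \<alpha> by (auto simp: b_def)
  have t: "t = 1 + b + (1 + b + b\<^sup>2) * norm d" by (simp add: t_def algebra_simps)
  have tpos: "t > 0" unfolding t using b01 by (intro add_pos_nonneg) auto
  have "shadow z = shadow w + d" by (simp add: d_def)
  also have "\<dots> = (1 + norm d) *\<^sub>R shadow w" using d[symmetric] by (simp add: scaleR_add_left)
  finally have tw: "t *\<^sub>R shadow w = v"
    using cycle by (simp add: t_def algebra_simps)
  have "norm (shadow w) = 1"
  \<comment> \<open>If \<open>d = 0\<close>, then \<open>v\<close> would have norm at most
    \<open>1 + b = 2 - \<alpha>\<close>, contrary to \<open>large\<close>; otherwise
    \<open>dw\<close> itself forces norm 1.\<close>
  proof (cases "d = 0")
    case True
    then have "norm v = (1 + b) * norm (shadow w)"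
      using tw[symmetric] b01 by (simp add: t)
    also have "\<dots> \<le> 1 + b" using w1 b01 by (simp add: mult_left_le)
    finally show ?thesis using large by (simp add: v_def b_def)
  next
    case False
    have "norm d * 1 \<le> norm d * norm (shadow w)"
      using dw norm_cauchy_schwarz[of d "shadow w"] by simp
    then show ?thesis using False w1 by simp
  qed
  then have "sgn v = shadow w"
    using tpos unfolding tw[symmetric] by (simp add: sgn_scaleR sgn_div_norm)
  then show ?thesis using wC by (auto simp: v_def b_def)
qed

text \<open>The cycle is written down explicitly: \<open>z\<close> lies at distance \<open>s\<close>
  beyond \<open>w\<close> in the radial direction, and all planar parts are multiples of
  \<open>shadow w\<close>.\<close>

lemma shadow_imp_fixed_cycle:
  assumes C: "convex C" "closed C" "\<And>x. x \<in> C \<Longrightarrow> norm (shadow x) \<le> 1"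
    and \<alpha>: "0 < \<alpha>" "\<alpha> \<le> 1" and pq: "shadow p = p" "shadow q = q"
    and large: "norm ((1 - \<alpha>) *\<^sub>R p + q) > 2 - \<alpha>"
    and w: "w \<in> C" "shadow w = sgn ((1 - \<alpha>) *\<^sub>R p + q)"
  shows "\<exists>x. relaxed_proj \<alpha> C (relaxed_proj \<alpha> {x. shadow x = q} (relaxed_proj \<alpha> {x. shadow x = p} x)) = x"
proof -
  define b where "b = 1 - \<alpha>"
  have ab: "\<alpha> = 1 - b" by (simp add: b_def)
  define v where "v = b *\<^sub>R p + q"
  define k where "k = 1 + b + b\<^sup>2"
  \<comment> \<open>Solves \<open>norm v = 1 + b + k * s\<close>, the norm relation found for
    \<open>norm d\<close> in the converse direction; \<open>large\<close> makes it positive.\<close>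
  define s where "s = (norm v - (1 + b)) / k"
  define z where "z = w + s *\<^sub>R shadow w"
  define x where "x = \<alpha> *\<^sub>R w + b *\<^sub>R z"
  have b01: "0 \<le> b" "b < 1" using \<alpha> by (auto simp: b_def)
  have k: "k > 0" unfolding k_def using b01 by (intro add_pos_nonneg) auto
  have s: "s > 0" using large k by (simp add: s_def v_def b_def)
  have vnz: "v \<noteq> 0" using large \<alpha> by (auto simp: v_def b_def)
  have sw: "shadow w = sgn v" using w(2) by (simp add: v_def b_def)
  have sw1: "norm (shadow w) = 1" using vnz by (simp add: sw norm_sgn)
  have v: "v = (k * s + 1 + b) *\<^sub>R shadow w"
    using k vnz by (simp add: sw sgn_div_norm s_def)
  \<comment> \<open>\<open>C\<close> lies in the cylinder over the unit disc, and
    \<open>shadow w\<close> is an outward normal of that cylinder at \<open>w\<close>.\<close>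
  have "metric_proj C z = w"
  proof (rule metric_proj_unique[OF C(1,2) w(1)])
    fix y assume "y \<in> C"
    have "shadow w \<bullet> y = shadow w \<bullet> shadow y"
      using shadow_inner_swap[of "shadow w" y] by simp
    also have "\<dots> \<le> norm (shadow y)"
      using norm_cauchy_schwarz[of "shadow w" "shadow y"] sw1 by simp
    also have "\<dots> \<le> 1" using C(3)[OF \<open>y \<in> C\<close>] .
    also have "1 = shadow w \<bullet> w"
      using shadow_inner_swap[of "shadow w" w] sw1 by (simp add: norm_eq_1)
    finally have "shadow w \<bullet> (y - w) \<le> 0" by (simp add: inner_diff_right)
    then show "(z - w) \<bullet> (y - w) \<le> 0"
      using s by (simp add: z_def mult_nonneg_nonpos)
  qed
  then have "relaxed_proj \<alpha> C z = x" by (simp add: relaxed_proj_def x_def b_def)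
  moreover have "relaxed_proj \<alpha> {x. shadow x = q} (relaxed_proj \<alpha> {x. shadow x = p} x) = z"
  proof -
    have x: "x = w + (b * s) *\<^sub>R shadow w" by (simp add: x_def z_def ab algebra_simps)
    have "relaxed_proj \<alpha> {x. shadow x = q} (relaxed_proj \<alpha> {x. shadow x = p} x)
        = x - shadow x + b\<^sup>2 *\<^sub>R shadow x + \<alpha> *\<^sub>R v"
      using pq by (simp add: relaxed_proj_fibre ab v_def algebra_simps power2_eq_square)
    also have "\<dots> = w + (b\<^sup>2 * (1 + b * s) - 1 + \<alpha> * (k * s + 1 + b)) *\<^sub>R shadow w"
      unfolding x by (subst v) (simp add: algebra_simps)
    also have "b\<^sup>2 * (1 + b * s) - 1 + \<alpha> * (k * s + 1 + b) = s"
      by (simp add: ab k_def algebra_simps power2_eq_square)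
    finally show ?thesis by (simp add: z_def)
  qed
  ultimately show ?thesis by metis
qed

end

section \<open>Padding with whole spaces and assembling the equivalence\<close>

lemma relaxed_comp_tail_UNIV:
  assumes "\<And>i. i > m \<Longrightarrow> A i = UNIV" "k \<ge> m"
  shows "relaxed_comp \<alpha> A k = relaxed_comp \<alpha> A m"
  using assms(2)
proof (induction k rule: dec_induct)
  case (step k)
  then show ?case
    using assms(1)[of "Suc k"] by (auto simp: relaxed_proj_def metric_proj_UNIV algebra_simps)
qed simp

theorem theorem1:
  fixes F :: "real set" and k :: nat
  assumes dimH: "\<exists>S :: 'a::{real_inner,complete_space} set. independent S \<and> finite S \<and> card S = 3"
    and k3: "k \<ge> 3"
    and Fsub: "F \<subseteq> {0..1}"
  shows "(\<exists>A :: nat \<Rightarrow> 'a set.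
            (\<forall>i\<in>{1..k}. A i \<noteq> {} \<and> convex (A i) \<and> closed (A i)) \<and>
            F = {\<alpha> \<in> {0..1}. \<exists>x. relaxed_comp \<alpha> A k x = x})
         \<longleftrightarrow> (0 \<in> F \<and> fsigma_in (top_of_set {0..1}) F)"
proof
  assume "\<exists>A :: nat \<Rightarrow> 'a set.
            (\<forall>i\<in>{1..k}. A i \<noteq> {} \<and> convex (A i) \<and> closed (A i)) \<and>
            F = {\<alpha> \<in> {0..1}. \<exists>x. relaxed_comp \<alpha> A k x = x}"
  then obtain A :: "nat \<Rightarrow> 'a set"
    where A: "\<forall>i\<in>{1..k}. A i \<noteq> {} \<and> convex (A i) \<and> closed (A i)"
      and F: "F = {\<alpha> \<in> {0..1}. \<exists>x. relaxed_comp \<alpha> A k x = x}" by blast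
  have "relaxed_comp 0 A n x = x" for n x
    by (induction n) (auto simp: relaxed_proj_def)
  then have "0 \<in> F" by (simp add: F)
  then show "0 \<in> F \<and> fsigma_in (top_of_set {0..1}) F"
    using fixed_point_parameters_fsigma[OF A] F by simp
next
  assume F: "0 \<in> F \<and> fsigma_in (top_of_set {0..1}) F"
  obtain e1 e2 e3 :: 'a where "orthonormal_frame e1 e2 e3"
    using orthonormal_triple[OF dimH] by (metis orthonormal_frame.intro)
  then interpret orthonormal_frame e1 e2 e3 .
  \<comment> \<open>In the plane \<open>v \<alpha>\<close> has coordinates
    \<open>2 * (2 - \<alpha>)\<close> and \<open>2 * (1 - \<alpha>)\<close>: the first alone exceeds
    \<open>2 - \<alpha>\<close>, and their ratio determines \<alpha>.\<close>
  define p q where "p = 2 *\<^sub>R e1 + 2 *\<^sub>R e2" and "q = 2 *\<^sub>R e1"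
  have pq: "shadow p = p" "shadow q = q" by (simp_all add: p_def q_def)
  define v where "v \<alpha> = (1 - \<alpha>) *\<^sub>R p + q" for \<alpha>
  have v1: "v \<alpha> \<bullet> e1 = 2 * (2 - \<alpha>)" and v2: "v \<alpha> \<bullet> e2 = 2 * (1 - \<alpha>)" for \<alpha>
    by (simp_all add: v_def p_def q_def inner_add_left algebra_simps)
  have large: "norm (v \<alpha>) > 2 - \<alpha>" if "\<alpha> \<in> {0..1}" for \<alpha>
    using norm_cauchy_schwarz[of "v \<alpha>" e1] that by (simp add: v1 unit)
  have nz: "v \<alpha> \<noteq> 0" if "\<alpha> \<in> {0..1}" for \<alpha> using large[OF that] that by auto
  have "inj_on (\<lambda>\<alpha>. sgn (v \<alpha>)) {0..1}"
  proof (rule inj_onI)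
    fix \<alpha> \<beta> :: real assume ab: "\<alpha> \<in> {0..1}" "\<beta> \<in> {0..1}" and eq: "sgn (v \<alpha>) = sgn (v \<beta>)"
    have "sgn (v \<alpha>) \<bullet> e1 = sgn (v \<beta>) \<bullet> e1" "sgn (v \<alpha>) \<bullet> e2 = sgn (v \<beta>) \<bullet> e2" by (simp_all add: eq)
    then have *: "(2 * (2 - \<alpha>)) * norm (v \<beta>) = (2 * (2 - \<beta>)) * norm (v \<alpha>)"
      "(2 * (1 - \<alpha>)) * norm (v \<beta>) = (2 * (1 - \<beta>)) * norm (v \<alpha>)"
      using nz ab by (simp_all add: sgn_div_norm v1 v2 field_simps)
    \<comment> \<open>The coordinates differ by 2 for every parameter, so subtracting the two
      equations leaves the norms.\<close>
    then have "norm (v \<alpha>) = norm (v \<beta>)" by (simp add: algebra_simps)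
    then show "\<alpha> = \<beta>" using * nz ab by simp
  qed
  moreover have "continuous_on {0..1} (\<lambda>\<alpha>. sgn (v \<alpha>))"
    unfolding sgn_div_norm using nz unfolding v_def by (intro continuous_intros) auto
  moreover have "shadow (sgn (v \<alpha>)) = sgn (v \<alpha>)" for \<alpha>
    using pq by (simp add: sgn_div_norm v_def)
  ultimately obtain C where C: "convex C" "closed C" "\<And>x. x \<in> C \<Longrightarrow> norm (shadow x) \<le> 1"
      and disc: "\<And>y. norm (shadow y) < 1 \<Longrightarrow> \<exists>x\<in>C. shadow x = shadow y"
      and inF: "\<And>\<alpha>. \<alpha> \<in> F \<Longrightarrow> \<exists>x\<in>C. shadow x = sgn (v \<alpha>)"
      and notF: "\<And>\<alpha> x. \<alpha> \<in> {0..1} - F \<Longrightarrow> x \<in> C \<Longrightarrow> shadow x \<noteq> sgn (v \<alpha>)"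
    using convex_set_with_fsigma_shadow[of F "\<lambda>\<alpha>. sgn (v \<alpha>)"] F nz by (auto simp: norm_sgn)
  have ne: "C \<noteq> {}" using inF F by blast
  define A where "A i = (if i = 1 then {x. shadow x = p} else if i = 2 then {x. shadow x = q}
    else if i = 3 then C else UNIV)" for i :: nat
  have comp: "relaxed_comp \<alpha> A k x = relaxed_proj \<alpha> C
      (relaxed_proj \<alpha> {x. shadow x = q} (relaxed_proj \<alpha> {x. shadow x = p} x))" for \<alpha> x
    using relaxed_comp_tail_UNIV[of 3 A k \<alpha>] k3 by (simp add: A_def numeral_3_eq_3 numeral_2_eq_2)
  have "\<alpha> \<in> F \<longleftrightarrow> (\<exists>x. relaxed_comp \<alpha> A k x = x)" if \<alpha>: "\<alpha> \<in> {0..1}" for \<alpha>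
  \<comment> \<open>The cycle lemmas divide by \<alpha>; at 0 the composition is the identity, and
    \<open>0 \<in> F\<close> is assumed.\<close>
  proof (cases "\<alpha> = 0")
    case True
    then show ?thesis using F by (simp add: comp relaxed_proj_def)
  next
    case False
    then have pos: "0 < \<alpha>" "\<alpha> \<le> 1" using \<alpha> by auto
    show ?thesis
      unfolding comp
      using fixed_cycle_shadow[OF ne C disc pos pq large[OF \<alpha>, unfolded v_def]]
        shadow_imp_fixed_cycle[OF C pos pq large[OF \<alpha>, unfolded v_def]]
        inF[of \<alpha>] notF[of \<alpha>] \<alpha> unfolding v_def by blast
  qed
  then have "F = {\<alpha> \<in> {0..1}. \<exists>x. relaxed_comp \<alpha> A k x = x}" using Fsub by blast
  moreover have "\<forall>i\<in>{1..k}. A i \<noteq> {} \<and> convex (A i) \<and> closed (A i)"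
    using fibre_closed_convex[OF pq(1)] fibre_closed_convex[OF pq(2)] ne C by (simp add: A_def)
  ultimately show "\<exists>A :: nat \<Rightarrow> 'a set.
      (\<forall>i\<in>{1..k}. A i \<noteq> {} \<and> convex (A i) \<and> closed (A i)) \<and>
      F = {\<alpha> \<in> {0..1}. \<exists>x. relaxed_comp \<alpha> A k x = x}" by blast
qed

end
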